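(* Let $K$ be a CW 2-pseudomanifold whose 2-cells are simple polygons. Then the polygonal cup product $\cup$ on the real-valued cochains of $K$ is a cup product in the abstract sense, i.e., it is a bilinear operation $\cup:C^p(K,\mathbb{R})\times C^q(K,\mathbb{R})\to C^{p+q}(K,\mathbb{R})$ (for all degrees $p,q$) satisfying: 1. For every $p$-cell $\sigma_p$ and $q$-cell $\sigma_q$ of $K$ with corresponding elementary cochains $\sigma^p,\sigma^q$, the cochain $\sigma^p\cup\sigma^q$ is a $(p+q)$-cochain in $St(\sigma_p)\cdot St(\sigma_q)$. 2. (Leibniz rule) $d(c^p\cup c^q)=dc^p\cup c^q+(-1)^p c^p\cup dc^q$ for all $c^p\in C^p(K,\mathbb{R})$, $c^q\in C^q(K,\mathbb{R})$. 3. If $K$ is connected, then there exists a real number $\gamma_\cup$ such that $I^0\cup c^p=c^p\cup I^0=\gamma_\cup c^p$ for all $p$ and all $c^p\in C^p(K,\mathbb{R})$, where $I^0$ is the constant 0-cochain that takes value 1 on every 0-cell of $K$.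
   Context: **Pseudomanifold.** A finite regular CW complex is a CW complex with finitely many cells whose characteristic maps can be taken to be homeomorphisms onto the closed cells and such that the boundary of each cell is a union of open cells. A cell $e$ is a face of a cell $e'$ if $e$ is contained in the closure of $e'$ (a cell is a face of itself). A CW $n$-pseudomanifold is an $n$-dimensional finite regular CW complex such that (1) every cell is a face of some $n$-cell; (2) every $(n-1)$-cell is a face of at most two $n$-cells; (3) any two $n$-cells $a,b$ are joined by a sequence of $n$-cells $a=e_0,\dots,e_k=b$ in which consecutive cells have a common $(n-1)$-dimensional face. Here $n=2$, and the 2-cells are simple polygons: each oriented 2-cell (face) is written $f=(v_0,\dots,v_{p-1})$, where $p\ge 3$ and $v_0,\dots,v_{p-1}$ are its distinct vertices in cyclic order, and its boundary consists of the oriented edges $e_i=(v_i,v_{i+1})$, $0\le i\le p-1$, indices modulo $p$. The number $p$ may vary from face to face. **Chains and cochains.** $C_q(K)$ is the group of integer $q$-chains on oriented $q$-cells (reversing the orientation of a cell changes the sign), which is trivial for $q<0$ and $q>2$. The boundary is $\partial(v_i,v_j)=v_j-v_i$ on edges and $\partial f=\sum_{i=0}^{p-1}e_i$ on faces. Real-valued discrete $q$-forms are the elements of $C^q(K,\mathbb{R})=\mathrm{Hom}(C_q(K),\mathbb{R})$. The discrete exterior derivative $d:C^q(K,\mathbb{R})\to C^{q+1}(K,\mathbb{R})$ is the coboundary operator, $(d\alpha)(c)=\alpha(\partial c)$ for $c\in C_{q+1}(K)$. The elementary cochain $\sigma^q$ of an oriented $q$-cell $\sigma_q$ takes value $1$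 on $\sigma_q$ and $0$ on all other $q$-cells (with fixed orientations). **Stars.** $St(\sigma)$ is the collection of all cells of $K$ of which $\sigma$ is a face. $A\cdot B$ is the collection of all cells belonging to both $A$ and $B$. A cochain is "in $A\cdot B$" if it vanishes on all cells not in $A\cdot B$. **Polygonal cup product** $\cup:C^k(K,\mathbb{R})\times C^l(K,\mathbb{R})\to C^{k+l}(K,\mathbb{R})$. Superscripts denote degrees of forms. For a vertex $v$, an edge $e=(v_i,v_j)$, and a face $f=(v_0,\dots,v_{p-1})$ with edges $e_i=(v_i,v_{i+1})$ (indices modulo $p$): $$(\alpha^0\cup\beta^0)(v)=\alpha(v)\beta(v),$$ $$(\alpha^0\cup\beta^1)(e)=\tfrac12(\alpha(v_i)+\alpha(v_j))\,\beta(e),$$ $$(\alpha^0\cup\beta^2)(f)=\tfrac1p\Big(\sum_{i=0}^{p-1}\alpha(v_i)\Big)\beta(f),$$ $$(\alpha^1\cup\beta^1)(f)=\sum_{i=0}^{p-1}\alpha(e_i)\sum_{a=1}^{\lfloor (p-1)/2\rfloor}\Big(\tfrac12-\tfrac ap\Big)\big(\beta(e_{i+a})-\beta(e_{i-a})\big).$$ The products of a 1-form or a 2-form with a 0-form on the right are given by the same expressions: $\beta^1\cup\alpha^0=\alpha^0\cup\beta^1$ and $\beta^2\cup\alpha^0=\alpha^0\cup\beta^2$. Products of total degree greater than 2 are $0$. *)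

theory Defs
  imports "HOL-Analysis.Analysis" "HOL-Algebra.Free_Abelian_Groups"
begin

section \<open>Finite regular CW complexes and pseudomanifolds\<close>

definition closed_disc :: "nat \<Rightarrow> (nat \<Rightarrow> real) topology" where
  "closed_disc q = subtopology (Euclidean_space q) {x. (\<Sum>i<q. x i ^ 2) \<le> 1}"

definition open_disc :: "nat \<Rightarrow> (nat \<Rightarrow> real) set" where
  "open_disc q = {x \<in> topspace (Euclidean_space q). (\<Sum>i<q. x i ^ 2) < 1}"

text \<open>\<open>cells K q\<close> is the set of open \<open>q\<close>-cells, as subsets of the underlying space.\<close>

record 'a cw_complex =
  underlying :: "'a topology"
  cells :: "nat \<Rightarrow> 'a set set"

text \<open>Since there are only finitely many cells, closure-finiteness and the weak topology are
  automatic and are not listed.\<close>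

definition finite_regular_CW :: "('a, 'b) cw_complex_scheme \<Rightarrow> bool" where
  "finite_regular_CW K \<longleftrightarrow>
     Hausdorff_space (underlying K) \<and>
     finite (SIGMA q:UNIV. cells K q) \<and>
     topspace (underlying K) = (\<Union>q. \<Union>(cells K q)) \<and>
     (\<forall>p q. \<forall>\<sigma>\<in>cells K p. \<forall>\<tau>\<in>cells K q. (p, \<sigma>) \<noteq> (q, \<tau>) \<longrightarrow> \<sigma> \<inter> \<tau> = {}) \<and>
     (\<forall>q. \<forall>\<sigma>\<in>cells K q.
        (\<exists>\<phi>. homeomorphic_map (closed_disc q)
               (subtopology (underlying K) (underlying K closure_of \<sigma>)) \<phi> \<and>
             \<phi> ` open_disc q = \<sigma>) \<and>
        (\<exists>S. S \<subseteq> (\<Union>r<q. cells K r) \<and> underlying K closure_of \<sigma> - \<sigma> = \<Union>S))"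

definition is_face :: "('a, 'b) cw_complex_scheme \<Rightarrow> 'a set \<Rightarrow> 'a set \<Rightarrow> bool" where
  "is_face K \<sigma> \<tau> \<longleftrightarrow> \<sigma> \<subseteq> underlying K closure_of \<tau>"

definition CW_pseudomanifold :: "nat \<Rightarrow> ('a, 'b) cw_complex_scheme \<Rightarrow> bool" where
  "CW_pseudomanifold n K \<longleftrightarrow>
     finite_regular_CW K \<and>
     cells K n \<noteq> {} \<and> (\<forall>q>n. cells K q = {}) \<and>
     (\<forall>q. \<forall>\<sigma>\<in>cells K q. \<exists>\<tau>\<in>cells K n. is_face K \<sigma> \<tau>) \<and>
     (\<forall>\<sigma>\<in>cells K (n - 1). card {\<tau> \<in> cells K n. is_face K \<sigma> \<tau>} \<le> 2) \<and>
     (\<forall>a\<in>cells K n. \<forall>b\<in>cells K n. \<exists>k e. e 0 = a \<and> e k = b \<and>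
        (\<forall>i\<le>k. e i \<in> cells K n) \<and>
        (\<forall>i<k. \<exists>\<sigma>\<in>cells K (n - 1). is_face K \<sigma> (e i) \<and> is_face K \<sigma> (e (Suc i))))"

section \<open>Oriented polygonal complexes\<close>

text \<open>Fixed orientations: an edge \<open>e\<close> is oriented from \<open>edge_tail K e\<close> to \<open>edge_head K e\<close>, and
  \<open>face_vertices K f\<close> lists the vertices \<open>v\<^sub>0, \<dots>, v\<^bsub>p-1\<^esub>\<close> of the oriented face \<open>f\<close>.
  Distinct edges may have the same pair of end points.\<close>

record 'a oriented_complex = "'a cw_complex" +
  edge_tail :: "'a set \<Rightarrow> 'a set"
  edge_head :: "'a set \<Rightarrow> 'a set"
  face_vertices :: "'a set \<Rightarrow> 'a set list"

abbreviation face_size :: "('a, 'b) oriented_complex_scheme \<Rightarrow> 'a set \<Rightarrow> nat" where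
  "face_size K f \<equiv> length (face_vertices K f)"

definition face_vertex :: "('a, 'b) oriented_complex_scheme \<Rightarrow> 'a set \<Rightarrow> nat \<Rightarrow> 'a set" where
  "face_vertex K f i = face_vertices K f ! (i mod face_size K f)"

definition is_side :: "('a, 'b) oriented_complex_scheme \<Rightarrow> 'a set \<Rightarrow> nat \<Rightarrow> 'a set \<Rightarrow> bool" where
  "is_side K f i e \<longleftrightarrow> e \<in> cells K 1 \<and> is_face K e f \<and>
     {edge_tail K e, edge_head K e} = {face_vertex K f i, face_vertex K f (Suc i)}"

definition simple_polygon :: "('a, 'b) oriented_complex_scheme \<Rightarrow> 'a set \<Rightarrow> bool" where
  "simple_polygon K f \<longleftrightarrow>
     face_size K f \<ge> 3 \<and> distinct (face_vertices K f) \<and>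
     set (face_vertices K f) = {v \<in> cells K 0. is_face K v f} \<and>
     (\<forall>i<face_size K f. \<exists>!e. is_side K f i e) \<and>
     (\<forall>e\<in>cells K 1. is_face K e f \<longrightarrow> (\<exists>i<face_size K f. is_side K f i e))"

definition oriented_polygonal :: "('a, 'b) oriented_complex_scheme \<Rightarrow> bool" where
  "oriented_polygonal K \<longleftrightarrow>
     (\<forall>e\<in>cells K 1. edge_tail K e \<noteq> edge_head K e \<and>
        {edge_tail K e, edge_head K e} = {v \<in> cells K 0. is_face K v e}) \<and>
     (\<forall>f\<in>cells K 2. simple_polygon K f)"

section \<open>Chains and cochains\<close>

text \<open>\<open>C\<^sub>q(K)\<close> is free on the \<open>q\<close>-cells with their fixed orientations; the cell with the opposite
  orientation is the negative of the generator.\<close>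

definition chains :: "('a, 'b) cw_complex_scheme \<Rightarrow> nat \<Rightarrow> ('a set \<Rightarrow>\<^sub>0 int) monoid" where
  "chains K q = free_Abelian_group (cells K q)"

text \<open>The side \<open>e\<^sub>i = (v\<^sub>i, v\<^bsub>i+1\<^esub>)\<close> of \<open>f\<close>, oriented along \<open>f\<close>, as a 1-chain.\<close>

definition side_chain :: "('a, 'b) oriented_complex_scheme \<Rightarrow> 'a set \<Rightarrow> nat \<Rightarrow> ('a set \<Rightarrow>\<^sub>0 int)" where
  "side_chain K f i =
     (let e = (THE e. is_side K f i e)
      in if edge_tail K e = face_vertex K f i then frag_of e else - frag_of e)"

definition boundary :: "('a, 'b) oriented_complex_scheme \<Rightarrow> nat \<Rightarrow> ('a set \<Rightarrow>\<^sub>0 int) \<Rightarrow> ('a set \<Rightarrow>\<^sub>0 int)" where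
  "boundary K q = frag_extend (\<lambda>\<sigma>.
     if q = 1 then frag_of (edge_head K \<sigma>) - frag_of (edge_tail K \<sigma>)
     else if q = 2 then (\<Sum>i<face_size K \<sigma>. side_chain K \<sigma> i)
     else 0)"

definition real_additive_group :: "real monoid" where
  "real_additive_group = \<lparr>carrier = UNIV, monoid.mult = (+), one = 0\<rparr>"

text \<open>\<open>C\<^sup>q(K,\<real>) = Hom(C\<^sub>q(K),\<real>)\<close>; homomorphisms are extended by 0 outside \<open>C\<^sub>q(K)\<close> so that equality
  of functions is equality of cochains and the vector space operations are pointwise.\<close>

type_synonym 'a cochain = "('a set \<Rightarrow>\<^sub>0 int) \<Rightarrow> real"

definition cochains :: "('a, 'b) cw_complex_scheme \<Rightarrow> nat \<Rightarrow> 'a cochain set" where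
  "cochains K q = {\<alpha> \<in> hom (chains K q) real_additive_group. \<forall>c. c \<notin> carrier (chains K q) \<longrightarrow> \<alpha> c = 0}"

definition cochain_of :: "('a, 'b) cw_complex_scheme \<Rightarrow> nat \<Rightarrow> ('a set \<Rightarrow> real) \<Rightarrow> 'a cochain" where
  "cochain_of K q h = (\<lambda>c. if c \<in> carrier (chains K q)
     then \<Sum>\<sigma>\<in>Poly_Mapping.keys c. real_of_int (Poly_Mapping.lookup c \<sigma>) * h \<sigma> else 0)"

definition exterior_d :: "('a, 'b) oriented_complex_scheme \<Rightarrow> nat \<Rightarrow> 'a cochain \<Rightarrow> 'a cochain" where
  "exterior_d K q \<alpha> = (\<lambda>c. if c \<in> carrier (chains K (Suc q)) then \<alpha> (boundary K (Suc q) c) else 0)"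

definition elementary_cochain :: "('a, 'b) cw_complex_scheme \<Rightarrow> nat \<Rightarrow> 'a set \<Rightarrow> 'a cochain" where
  "elementary_cochain K q \<sigma> = cochain_of K q (\<lambda>\<tau>. if \<tau> = \<sigma> then 1 else 0)"

definition unit_cochain :: "('a, 'b) cw_complex_scheme \<Rightarrow> 'a cochain" where
  "unit_cochain K = cochain_of K 0 (\<lambda>v. 1)"

definition star :: "('a, 'b) cw_complex_scheme \<Rightarrow> 'a set \<Rightarrow> 'a set set" where
  "star K \<sigma> = {\<tau> \<in> (\<Union>q. cells K q). is_face K \<sigma> \<tau>}"

definition cochains_in :: "('a, 'b) cw_complex_scheme \<Rightarrow> nat \<Rightarrow> 'a set set \<Rightarrow> 'a cochain set" where
  "cochains_in K q A = {\<alpha> \<in> cochains K q. \<forall>\<sigma>\<in>cells K q. \<sigma> \<notin> A \<longrightarrow> \<alpha> (frag_of \<sigma>) = 0}"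

section \<open>Cup products\<close>

text \<open>\<open>cup p q\<close> is the product \<open>C\<^sup>p \<times> C\<^sup>q \<rightarrow> C\<^bsup>p+q\<^esup>\<close>.\<close>

definition bilinear_product ::
  "('a, 'b) cw_complex_scheme \<Rightarrow> (nat \<Rightarrow> nat \<Rightarrow> 'a cochain \<Rightarrow> 'a cochain \<Rightarrow> 'a cochain) \<Rightarrow> bool" where
  "bilinear_product K cup \<longleftrightarrow> (\<forall>p q.
     (\<forall>\<alpha>\<in>cochains K p. \<forall>\<beta>\<in>cochains K q. cup p q \<alpha> \<beta> \<in> cochains K (p + q)) \<and>
     (\<forall>\<alpha>\<in>cochains K p. \<forall>\<alpha>'\<in>cochains K p. \<forall>\<beta>\<in>cochains K q. \<forall>a b :: real.
        cup p q (\<lambda>c. a * \<alpha> c + b * \<alpha>' c) \<beta> = (\<lambda>c. a * cup p q \<alpha> \<beta> c + b * cup p q \<alpha>' \<beta> c)) \<and>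
     (\<forall>\<alpha>\<in>cochains K p. \<forall>\<beta>\<in>cochains K q. \<forall>\<beta>'\<in>cochains K q. \<forall>a b :: real.
        cup p q \<alpha> (\<lambda>c. a * \<beta> c + b * \<beta>' c) = (\<lambda>c. a * cup p q \<alpha> \<beta> c + b * cup p q \<alpha> \<beta>' c)))"

definition cup_product ::
  "('a, 'b) oriented_complex_scheme \<Rightarrow> (nat \<Rightarrow> nat \<Rightarrow> 'a cochain \<Rightarrow> 'a cochain \<Rightarrow> 'a cochain) \<Rightarrow> bool" where
  "cup_product K cup \<longleftrightarrow>
     bilinear_product K cup \<and>
     (\<forall>p q. \<forall>\<sigma>\<in>cells K p. \<forall>\<tau>\<in>cells K q.
        cup p q (elementary_cochain K p \<sigma>) (elementary_cochain K q \<tau>)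
          \<in> cochains_in K (p + q) (star K \<sigma> \<inter> star K \<tau>)) \<and>
     (\<forall>p q. \<forall>\<alpha>\<in>cochains K p. \<forall>\<beta>\<in>cochains K q.
        exterior_d K (p + q) (cup p q \<alpha> \<beta>) =
          (\<lambda>c. cup (Suc p) q (exterior_d K p \<alpha>) \<beta> c
                + (-1) ^ p * cup p (Suc q) \<alpha> (exterior_d K q \<beta>) c)) \<and>
     (connected_space (underlying K) \<longrightarrow>
        (\<exists>\<gamma>::real. \<forall>p. \<forall>\<alpha>\<in>cochains K p.
           cup 0 p (unit_cochain K) \<alpha> = (\<lambda>c. \<gamma> * \<alpha> c) \<and>
           cup p 0 \<alpha> (unit_cochain K) = (\<lambda>c. \<gamma> * \<alpha> c)))"

definition cup01 :: "('a, 'b) oriented_complex_scheme \<Rightarrow> 'a cochain \<Rightarrow> 'a cochain \<Rightarrow> 'a set \<Rightarrow> real" where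
  "cup01 K \<alpha> \<beta> e =
     1/2 * (\<alpha> (frag_of (edge_tail K e)) + \<alpha> (frag_of (edge_head K e))) * \<beta> (frag_of e)"

definition cup02 :: "('a, 'b) oriented_complex_scheme \<Rightarrow> 'a cochain \<Rightarrow> 'a cochain \<Rightarrow> 'a set \<Rightarrow> real" where
  "cup02 K \<alpha> \<beta> f =
     1 / real (face_size K f) * (\<Sum>i<face_size K f. \<alpha> (frag_of (face_vertex K f i))) * \<beta> (frag_of f)"

text \<open>Below \<open>i + p - a\<close> stands for \<open>i - a\<close> modulo \<open>p\<close>, as \<open>a < p\<close>.\<close>

definition cup11 :: "('a, 'b) oriented_complex_scheme \<Rightarrow> 'a cochain \<Rightarrow> 'a cochain \<Rightarrow> 'a set \<Rightarrow> real" where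
  "cup11 K \<alpha> \<beta> f =
     (let p = face_size K f; e = side_chain K f in
      \<Sum>i<p. \<alpha> (e i) *
        (\<Sum>a = 1..(p - 1) div 2. (1/2 - real a / real p) *
           (\<beta> (e ((i + a) mod p)) - \<beta> (e ((i + p - a) mod p)))))"

definition polygonal_cup ::
  "('a, 'b) oriented_complex_scheme \<Rightarrow> nat \<Rightarrow> nat \<Rightarrow> 'a cochain \<Rightarrow> 'a cochain \<Rightarrow> 'a cochain" where
  "polygonal_cup K p q \<alpha> \<beta> = cochain_of K (p + q) (\<lambda>\<sigma>.
     if (p, q) = (0, 0) then \<alpha> (frag_of \<sigma>) * \<beta> (frag_of \<sigma>)
     else if (p, q) = (0, 1) then cup01 K \<alpha> \<beta> \<sigma>
     else if (p, q) = (1, 0) then cup01 K \<beta> \<alpha> \<sigma>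
     else if (p, q) = (0, 2) then cup02 K \<alpha> \<beta> \<sigma>
     else if (p, q) = (2, 0) then cup02 K \<beta> \<alpha> \<sigma>
     else if (p, q) = (1, 1) then cup11 K \<alpha> \<beta> \<sigma>
     else 0)"

end

theory Submission
  imports Defs
begin

text \<open>
  A cochain is determined by its values on cells (\<open>cochain_eqI\<close>), and there are no cells above
  dimension 2, so every identity reduces to a computation on a single vertex, edge or polygon. Only
  one of these computations has substance: the Leibniz rule on a polygon for a 0-form \<open>\<alpha>\<close> and a
  1-form \<open>\<beta>\<close>.

  Let the polygon have \<open>p\<close> vertices, let \<open>u\<^sub>i\<close> be the value of \<open>\<alpha>\<close> at the \<open>i\<close>-th vertex and
  \<open>y\<^sub>i\<close> the value of \<open>\<beta>\<close> on the \<open>i\<close>-th side. The weight \<open>w\<^sub>a = 1/2 - a/p\<close> changes sign under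
  \<open>a \<mapsto> p - a\<close>, so the folded sum in the product of 1-forms is the sum of
  \<open>w\<^sub>a x\<^sub>i y\<^bsub>i+a\<^esub>\<close> over all \<open>i\<close> and all \<open>0 < a < p\<close> (\<open>folded_weighted_sum\<close>). In this form two
  facts are visible. The product is anticommutative (\<open>cyclic_product_anticommute\<close>), so that the
  Leibniz rules for the degrees (0,1) and (1,0) are equivalent. And since consecutive weights
  differ by \<open>1/p\<close>, summation by parts of \<open>w\<^sub>a (u\<^bsub>i+a+1\<^esub> - u\<^bsub>i+a\<^esub>)\<close> over \<open>a\<close> gives the mean of \<open>u\<close>
  over the polygon minus its mean over the end points of the \<open>i\<close>-th side
  (\<open>cyclic_product_differences\<close>). Multiplied by \<open>y\<^sub>i\<close> and summed over \<open>i\<close>, the first mean yields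
  \<open>\<alpha> \<union> d\<beta>\<close> and the second \<open>d(\<alpha> \<union> \<beta>)\<close>.

  Locality holds because the formula on a cell evaluates both factors only on faces of that cell, and
  \<open>\<gamma> = 1\<close> because 0-forms enter through their means.
\<close>

section \<open>Cochains as functions on cells\<close>

lemma carrier_chains_iff: "c \<in> carrier (chains K q) \<longleftrightarrow> Poly_Mapping.keys c \<subseteq> cells K q"
  by (simp add: chains_def)

lemma cochains_iff:
  "\<alpha> \<in> cochains K q \<longleftrightarrow>
     (\<forall>c d. Poly_Mapping.keys c \<subseteq> cells K q \<longrightarrow> Poly_Mapping.keys d \<subseteq> cells K q \<longrightarrow>
        \<alpha> (c + d) = \<alpha> c + \<alpha> d) \<and>
     (\<forall>c. \<not> Poly_Mapping.keys c \<subseteq> cells K q \<longrightarrow> \<alpha> c = 0)"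
  by (auto simp: cochains_def hom_def chains_def real_additive_group_def)

lemma cochain_add:
  assumes "\<alpha> \<in> cochains K q" "Poly_Mapping.keys c \<subseteq> cells K q" "Poly_Mapping.keys d \<subseteq> cells K q"
  shows "\<alpha> (c + d) = \<alpha> c + \<alpha> d"
  using assms by (simp add: cochains_iff)

lemma cochain_outside:
  assumes "\<alpha> \<in> cochains K q" "\<not> Poly_Mapping.keys c \<subseteq> cells K q"
  shows "\<alpha> c = 0"
  using assms by (simp add: cochains_iff)

lemma cochain_zero: "\<alpha> \<in> cochains K q \<Longrightarrow> \<alpha> 0 = 0"
  using cochain_add[of \<alpha> K q 0 0] by simp

lemma cochain_uminus:
  assumes "\<alpha> \<in> cochains K q" "Poly_Mapping.keys c \<subseteq> cells K q"
  shows "\<alpha> (- c) = - \<alpha> c"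
  using cochain_add[of \<alpha> K q c "- c"] cochain_zero[of \<alpha> K q] assms by simp

lemma cochain_diff:
  assumes "\<alpha> \<in> cochains K q" "Poly_Mapping.keys c \<subseteq> cells K q" "Poly_Mapping.keys d \<subseteq> cells K q"
  shows "\<alpha> (c - d) = \<alpha> c - \<alpha> d"
  using cochain_add[of \<alpha> K q c "- d"] cochain_uminus[of \<alpha> K q d] assms by simp

lemma cochain_sum:
  assumes "\<alpha> \<in> cochains K q" "\<And>i. i < (n::nat) \<Longrightarrow> Poly_Mapping.keys (c i) \<subseteq> cells K q"
  shows "\<alpha> (\<Sum>i<n. c i) = (\<Sum>i<n. \<alpha> (c i))"
  using assms(2)
proof (induction n)
  case 0
  then show ?case using cochain_zero assms(1) by auto
next
  case (Suc n)
  have "(\<Sum>i<n. c i) \<in> carrier (free_Abelian_group (cells K q))"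
    by (intro sum_closed_free_Abelian_group) (use Suc.prems in auto)
  then show ?case
    using Suc cochain_add[OF assms(1), of "\<Sum>i<n. c i" "c n"] by simp
qed

lemma cochain_eqI:
  assumes "\<alpha> \<in> cochains K q" "\<beta> \<in> cochains K q"
    and eq: "\<And>\<sigma>. \<sigma> \<in> cells K q \<Longrightarrow> \<alpha> (frag_of \<sigma>) = \<beta> (frag_of \<sigma>)"
  shows "\<alpha> = \<beta>"
proof
  fix c
  show "\<alpha> c = \<beta> c"
  proof (cases "Poly_Mapping.keys c \<subseteq> cells K q")
    case True
    then show ?thesis
      by (rule free_Abelian_group_induct)
        (use assms in \<open>auto simp: cochain_zero cochain_diff\<close>)
  next
    case False
    then show ?thesis using assms cochain_outside by metis
  qed
qed

lemma cochain_of_in_cochains: "cochain_of K q h \<in> cochains K q"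
proof -
  have "(\<Sum>\<sigma>\<in>Poly_Mapping.keys (c + d). real_of_int (Poly_Mapping.lookup (c + d) \<sigma>) * h \<sigma>) =
      (\<Sum>\<sigma>\<in>Poly_Mapping.keys c. real_of_int (Poly_Mapping.lookup c \<sigma>) * h \<sigma>) +
      (\<Sum>\<sigma>\<in>Poly_Mapping.keys d. real_of_int (Poly_Mapping.lookup d \<sigma>) * h \<sigma>)" for c d
  proof -
    let ?U = "Poly_Mapping.keys c \<union> Poly_Mapping.keys d"
    have enlarge: "(\<Sum>\<sigma>\<in>Poly_Mapping.keys x. real_of_int (Poly_Mapping.lookup x \<sigma>) * h \<sigma>) =
        (\<Sum>\<sigma>\<in>?U. real_of_int (Poly_Mapping.lookup x \<sigma>) * h \<sigma>)"
      if "Poly_Mapping.keys x \<subseteq> ?U" for x :: "'a set \<Rightarrow>\<^sub>0 int"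
      using that by (intro sum.mono_neutral_left) (auto simp: in_keys_iff)
    show ?thesis
      using enlarge[of c] enlarge[of d] enlarge[of "c + d"] keys_add[of c d]
      by (simp add: lookup_add sum.distrib distrib_right)
  qed
  moreover have "Poly_Mapping.keys (c + d) \<subseteq> cells K q"
    if "Poly_Mapping.keys c \<subseteq> cells K q" "Poly_Mapping.keys d \<subseteq> cells K q" for c d :: "'a set \<Rightarrow>\<^sub>0 int"
    using that keys_add[of c d] by blast
  ultimately show ?thesis
    by (simp add: cochains_iff cochain_of_def carrier_chains_iff)
qed

lemma cochain_of_frag_of: "\<sigma> \<in> cells K q \<Longrightarrow> cochain_of K q h (frag_of \<sigma>) = h \<sigma>"
  by (simp add: cochain_of_def carrier_chains_iff)

lemma elementary_cochain_frag_of: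
  "\<tau> \<in> cells K q \<Longrightarrow> elementary_cochain K q \<sigma> (frag_of \<tau>) = (if \<tau> = \<sigma> then 1 else 0)"
  by (simp add: elementary_cochain_def cochain_of_frag_of)

lemma cochain_of_linear:
  "cochain_of K q (\<lambda>\<sigma>. a * g \<sigma> + b * h \<sigma>) = (\<lambda>c. a * cochain_of K q g c + b * cochain_of K q h c)"
  by (auto simp: cochain_of_def fun_eq_iff sum.distrib sum_distrib_left algebra_simps)

lemma cochains_linear:
  assumes "\<alpha> \<in> cochains K q" "\<beta> \<in> cochains K q"
  shows "(\<lambda>c. a * \<alpha> c + b * \<beta> c) \<in> cochains K q"
  using assms by (simp add: cochains_iff algebra_simps)

section \<open>Cyclic sums\<close>

text \<open>With \<open>x\<close> and \<open>y\<close> the values of two 1-forms on the sides of a \<open>p\<close>-gon, this is their product.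
  The weights \<open>1/2 - a/p\<close> are extended to the full range \<open>0 < a < p\<close>, on which they are
  antisymmetric under \<open>a \<mapsto> p - a\<close> and form an arithmetic progression: these two properties give
  the anticommutativity and the Leibniz rule.\<close>

definition cyclic_product :: "nat \<Rightarrow> (nat \<Rightarrow> real) \<Rightarrow> (nat \<Rightarrow> real) \<Rightarrow> real" where
  "cyclic_product p x y =
     (\<Sum>i<p. x i * (\<Sum>a = 1..<p. (1/2 - real a / real p) * y ((i + a) mod p)))"

lemma reflected_weight:
  "a \<le> p \<Longrightarrow> 0 < p \<Longrightarrow> 1/2 - real (p - a) / real p = - (1/2 - real a / real p)"
  by (simp add: of_nat_diff field_simps)

text \<open>The range of \<open>a\<close> unfolds because the terms with \<open>a > p/2\<close> are the reflections of those with
  \<open>a < p/2\<close>, and because for even \<open>p\<close> the middle weight at \<open>a = p/2\<close> is 0.\<close>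

lemma folded_weighted_sum:
  fixes g :: "nat \<Rightarrow> real"
  shows "(\<Sum>a = 1..(p - 1) div 2. (1/2 - real a / real p) * (g a - g (p - a))) =
         (\<Sum>a = 1..<p. (1/2 - real a / real p) * g a)"
proof (cases "p = 0")
  case False
  define m where "m = (p - 1) div 2"
  define w where "w = (\<lambda>a. 1/2 - real a / real p)"
  have w_reflected: "w (p - a) = - w a" if "a \<le> p" for a
    using that False unfolding w_def by (intro reflected_weight) auto
  have "m < p" using False by (auto simp: m_def)
  then have "(\<Sum>a = 1..<p. w a * g a) = (\<Sum>a = 1..m. w a * g a) + (\<Sum>a = Suc m..<p. w a * g a)"
    by (subst sum.union_disjoint[symmetric]) (auto intro!: sum.cong)
  also have "(\<Sum>a = Suc m..<p. w a * g a) = (\<Sum>a = 1..p - 1 - m. w (p - a) * g (p - a))"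
    using \<open>m < p\<close>
    by (intro sum.reindex_bij_witness[where i = "\<lambda>a. p - a" and j = "\<lambda>a. p - a"]) auto
  also have "\<dots> = (\<Sum>a = 1..p - 1 - m. - (w a * g (p - a)))"
    by (intro sum.cong) (auto simp: w_reflected)
  \<comment> \<open>\<open>p - 1 - m\<close> is \<open>m\<close> for odd \<open>p\<close> and \<open>m + 1 = p/2\<close> for even \<open>p\<close>.\<close>
  also have "\<dots> = (\<Sum>a = 1..m. - (w a * g (p - a)))"
  proof (rule sum.mono_neutral_right)
    show "\<forall>a\<in>{1..p - 1 - m} - {1..m}. - (w a * g (p - a)) = 0"
    proof
      fix a assume "a \<in> {1..p - 1 - m} - {1..m}"
      then have "2 * a = p" by (auto simp: m_def)
      then have "real p = 2 * real a" by auto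
      then show "- (w a * g (p - a)) = 0" using False by (auto simp: w_def field_simps)
    qed
  qed (auto simp: m_def)
  finally have "(\<Sum>a = 1..m. w a * (g a - g (p - a))) = (\<Sum>a = 1..<p. w a * g a)"
    by (simp add: right_diff_distrib sum_subtractf sum_negf)
  then show ?thesis
    by (simp add: w_def m_def)
qed simp

lemma sum_cyclic_shift:
  fixes g :: "nat \<Rightarrow> 'b::comm_monoid_add"
  assumes "a \<le> p"
  shows "(\<Sum>i<p. g ((i + a) mod p)) = (\<Sum>i<p. g i)"
proof (rule sum.reindex_bij_witness[where i = "\<lambda>j. (j + (p - a)) mod p" and j = "\<lambda>i. (i + a) mod p"])
  fix i assume "i \<in> {..<p}"
  then show "((i + a) mod p + (p - a)) mod p = i" "((i + (p - a)) mod p + a) mod p = i"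
    using assms mod_add_left_eq[of "i + a" p "p - a"] mod_add_left_eq[of "i + (p - a)" p a] by simp_all
qed auto

text \<open>Substituting \<open>j = i + a\<close> exchanges the two arguments and turns the offset \<open>a\<close> into \<open>p - a\<close>,
  whose weight has the opposite sign.\<close>

lemma cyclic_product_anticommute: "cyclic_product p x y = - cyclic_product p y x"
proof -
  define w where "w = (\<lambda>a. 1/2 - real a / real p)"
  have w_reflected: "w (p - a) = - w a" if "a < p" for a
    using that unfolding w_def by (intro reflected_weight) auto
  have shift: "(\<Sum>i<p. x i * y ((i + a) mod p)) = (\<Sum>i<p. x ((i + (p - a)) mod p) * y i)"
    if "a \<le> p" for a
  proof -
    have "(\<Sum>i<p. x i * y ((i + a) mod p)) =
          (\<Sum>i<p. x ((i + (p - a)) mod p) * y (((i + (p - a)) mod p + a) mod p))"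
      using sum_cyclic_shift[of "p - a" p "\<lambda>i. x i * y ((i + a) mod p)"] by simp
    also have "\<dots> = (\<Sum>i<p. x ((i + (p - a)) mod p) * y i)"
      using that by (intro sum.cong) (auto simp: mod_add_left_eq)
    finally show ?thesis .
  qed
  have "cyclic_product p x y = (\<Sum>a = 1..<p. w a * (\<Sum>i<p. x i * y ((i + a) mod p)))"
    unfolding cyclic_product_def w_def sum_distrib_left
    by (subst sum.swap) (simp add: mult_ac)
  also have "\<dots> = (\<Sum>a = 1..<p. w a * (\<Sum>i<p. x ((i + (p - a)) mod p) * y i))"
    using shift by simp
  also have "\<dots> = (\<Sum>a = 1..<p. w (p - a) * (\<Sum>i<p. x ((i + a) mod p) * y i))"
    by (intro sum.reindex_bij_witness[where i = "\<lambda>a. p - a" and j = "\<lambda>a. p - a"]) auto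
  also have "\<dots> = (\<Sum>a = 1..<p. - (w a * (\<Sum>i<p. x ((i + a) mod p) * y i)))"
    by (intro sum.cong) (auto simp: w_reflected)
  also have "\<dots> = - cyclic_product p y x"
    unfolding cyclic_product_def w_def sum_distrib_left sum_negf
    by (subst sum.swap) (simp add: mult_ac)
  finally show ?thesis .
qed

text \<open>Summation by parts: consecutive weights differ by the constant \<open>1/p\<close>, so that every inner
  value of \<open>g\<close> enters with the same coefficient.\<close>

lemma weighted_sum_of_differences:
  fixes g :: "nat \<Rightarrow> real"
  shows "(\<Sum>a = 1..n. (1/2 - real a / real p) * (g (Suc a) - g a)) =
         (1/2 - real n / real p) * g (Suc n) - 1/2 * g 1 + 1 / real p * (\<Sum>a = 1..n. g a)"
  by (induction n) (simp_all add: algebra_simps add_divide_distrib)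

text \<open>This is the Leibniz rule on a \<open>p\<close>-gon for a 1-form with values \<open>y\<close> on the sides and a 0-form
  with values \<open>u\<close> at the vertices: the end terms of the summation by parts yield the mean of \<open>u\<close>
  over the end points of each side, the inner terms its mean over all vertices.\<close>

lemma cyclic_product_differences:
  assumes "0 < p"
  shows "cyclic_product p y (\<lambda>i. u (Suc i mod p) - u i) =
         1 / real p * (\<Sum>i<p. u i) * (\<Sum>i<p. y i) - (\<Sum>i<p. 1/2 * (u i + u (Suc i mod p)) * y i)"
proof -
  have inner: "(\<Sum>a = 1..<p. (1/2 - real a / real p) * (u (Suc ((i + a) mod p) mod p) - u ((i + a) mod p)))
      = 1 / real p * (\<Sum>j<p. u j) - 1/2 * (u i + u (Suc i mod p))" if "i < p" for i
  proof -
    define g where "g = (\<lambda>a. u ((i + a) mod p))"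
    obtain n where p: "p = Suc n" using assms by (cases p) auto
    have "g (Suc n) = u i" using that by (simp add: g_def flip: p)
    moreover have "g 1 = u (Suc i mod p)" by (simp add: g_def)
    \<comment> \<open>The index \<open>a = p\<close> is added to complete a full cycle; its term \<open>u i\<close> is subtracted again below.\<close>
    moreover have "(\<Sum>a = 1..Suc n. g a) = (\<Sum>j<p. u j)"
    proof -
      have "(\<Sum>a = 1..Suc n. g a) = (\<Sum>a<p. u ((a + Suc i) mod p))"
        unfolding g_def p
        by (intro sum.reindex_bij_witness[where i = Suc and j = "\<lambda>a. a - 1"]) (auto simp: add_ac)
      also have "\<dots> = (\<Sum>j<p. u j)"
        using that by (intro sum_cyclic_shift) auto
      finally show ?thesis .
    qed
    ultimately have total: "(\<Sum>a = 1..n. g a) = (\<Sum>j<p. u j) - u i" by simp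
    have "(\<Sum>a = 1..<p. (1/2 - real a / real p) * (u (Suc ((i + a) mod p) mod p) - u ((i + a) mod p)))
        = (\<Sum>a = 1..n. (1/2 - real a / real p) * (g (Suc a) - g a))"
      unfolding g_def p atLeastLessThanSuc_atLeastAtMost
      by (intro sum.cong) (auto simp: mod_Suc_eq)
    also have "\<dots> = (1/2 - real n / real p) * u i - 1/2 * u (Suc i mod p)
        + 1 / real p * ((\<Sum>j<p. u j) - u i)"
      using total \<open>g (Suc n) = u i\<close> \<open>g 1 = _\<close> weighted_sum_of_differences[of p g n] by simp
    also have "\<dots> = 1 / real p * (\<Sum>j<p. u j) - 1/2 * (u i + u (Suc i mod p))"
    proof -
      have last_weight: "1/2 - real n / real p = 1 / real p - 1/2" by (simp add: p field_simps)
      show ?thesis unfolding last_weight by (simp add: algebra_simps diff_divide_distrib)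
    qed
    finally show ?thesis .
  qed
  have "cyclic_product p y (\<lambda>i. u (Suc i mod p) - u i) =
      (\<Sum>i<p. y i * (1 / real p * (\<Sum>j<p. u j) - 1/2 * (u i + u (Suc i mod p))))"
    unfolding cyclic_product_def by (intro sum.cong refl arg_cong2[where f = "(*)"] inner) simp
  also have "\<dots> = (\<Sum>i<p. 1 / real p * (\<Sum>j<p. u j) * y i) - (\<Sum>i<p. 1/2 * (u i + u (Suc i mod p)) * y i)"
    unfolding sum_subtractf[symmetric] by (intro sum.cong) (auto simp: algebra_simps)
  also have "(\<Sum>i<p. 1 / real p * (\<Sum>j<p. u j) * y i) = 1 / real p * (\<Sum>i<p. u i) * (\<Sum>i<p. y i)"
    by (rule sum_distrib_left[symmetric])
  finally show ?thesis .
qed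

lemma cup11_eq_cyclic_product:
  "cup11 K \<alpha> \<beta> f =
     cyclic_product (face_size K f) (\<lambda>i. \<alpha> (side_chain K f i)) (\<lambda>i. \<beta> (side_chain K f i))"
proof -
  define p where "p = face_size K f"
  define y where "y = (\<lambda>i. \<beta> (side_chain K f i))"
  have "(\<Sum>a = 1..(p - 1) div 2. (1/2 - real a / real p) * (y ((i + a) mod p) - y ((i + p - a) mod p)))
      = (\<Sum>a = 1..<p. (1/2 - real a / real p) * y ((i + a) mod p))" for i
  proof -
    have "(\<Sum>a = 1..(p - 1) div 2. (1/2 - real a / real p) * (y ((i + a) mod p) - y ((i + p - a) mod p)))
        = (\<Sum>a = 1..(p - 1) div 2. (1/2 - real a / real p) * (y ((i + a) mod p) - y ((i + (p - a)) mod p)))"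
      by (intro sum.cong) auto
    then show ?thesis
      using folded_weighted_sum[where g = "\<lambda>a. y ((i + a) mod p)" and p = p] by simp
  qed
  then show ?thesis
    by (simp add: cup11_def cyclic_product_def Let_def p_def y_def)
qed

lemma cup11_anticommute: "cup11 K \<alpha> \<beta> f = - cup11 K \<beta> \<alpha> f"
  unfolding cup11_eq_cyclic_product by (rule cyclic_product_anticommute)

lemma cyclic_product_linear_left:
  "cyclic_product p (\<lambda>i. a * x i + b * x' i) y = a * cyclic_product p x y + b * cyclic_product p x' y"
  by (simp add: cyclic_product_def distrib_right sum.distrib sum_distrib_left mult.assoc)

lemma cyclic_product_linear_right:
  "cyclic_product p x (\<lambda>i. a * y i + b * y' i) = a * cyclic_product p x y + b * cyclic_product p x y'"
  unfolding cyclic_product_anticommute[of p x] cyclic_product_linear_left by simp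

section \<open>Edges and sides of faces\<close>

lemma oriented_polygonal_edge:
  assumes "oriented_polygonal K" "e \<in> cells K 1"
  shows "edge_tail K e \<in> cells K 0" "edge_head K e \<in> cells K 0"
    "is_face K (edge_tail K e) e" "is_face K (edge_head K e) e"
  using assms unfolding oriented_polygonal_def by blast+

lemma boundary_edge: "boundary K 1 (frag_of e) = frag_of (edge_head K e) - frag_of (edge_tail K e)"
  by (simp add: boundary_def)

lemma boundary_face: "boundary K 2 (frag_of f) = (\<Sum>i<face_size K f. side_chain K f i)"
  by (simp add: boundary_def)

lemma exterior_d_edge:
  assumes "oriented_polygonal K" "\<alpha> \<in> cochains K 0" "e \<in> cells K 1"
  shows "exterior_d K 0 \<alpha> (frag_of e) = \<alpha> (frag_of (edge_head K e)) - \<alpha> (frag_of (edge_tail K e))"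
  using assms oriented_polygonal_edge[OF assms(1,3)] boundary_edge[of K e]
  by (simp add: exterior_d_def carrier_chains_iff cochain_diff)

locale polygonal_face =
  fixes K :: "('a, 'b) oriented_complex_scheme" and f :: "'a set"
  assumes polygonal: "oriented_polygonal K" and face: "f \<in> cells K 2"
begin

lemma face_size_ge_3: "face_size K f \<ge> 3"
  using polygonal face by (simp add: oriented_polygonal_def simple_polygon_def)

lemma face_vertex_is_vertex: "face_vertex K f i \<in> cells K 0" "is_face K (face_vertex K f i) f"
proof -
  have "face_vertex K f i \<in> set (face_vertices K f)"
    using face_size_ge_3 unfolding face_vertex_def by (intro nth_mem mod_less_divisor) auto
  moreover have "set (face_vertices K f) = {v \<in> cells K 0. is_face K v f}"
    using polygonal face by (simp add: oriented_polygonal_def simple_polygon_def)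
  ultimately show "face_vertex K f i \<in> cells K 0" "is_face K (face_vertex K f i) f"
    by blast+
qed

lemma face_vertex_mod: "face_vertex K f (i mod face_size K f) = face_vertex K f i"
  by (simp add: face_vertex_def)

text \<open>Either orientation of the edge is possible, so that the value of a 1-form on the side is the
  value on the edge up to this sign.\<close>

lemma side_cases:
  assumes "i < face_size K f"
  obtains e where "e \<in> cells K 1" "is_face K e f"
    "edge_tail K e = face_vertex K f i" "edge_head K e = face_vertex K f (Suc i)"
    "side_chain K f i = frag_of e"
  | e where "e \<in> cells K 1" "is_face K e f"
    "edge_tail K e = face_vertex K f (Suc i)" "edge_head K e = face_vertex K f i"
    "side_chain K f i = - frag_of e"
proof -
  define e where "e = (THE e. is_side K f i e)"
  have "\<exists>!e. is_side K f i e"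
    using polygonal face assms by (simp add: oriented_polygonal_def simple_polygon_def)
  then have "is_side K f i e"
    unfolding e_def by (rule theI')
  then have e: "e \<in> cells K 1" "is_face K e f"
    "{edge_tail K e, edge_head K e} = {face_vertex K f i, face_vertex K f (Suc i)}"
    by (auto simp: is_side_def)
  show thesis
  proof (cases "edge_tail K e = face_vertex K f i")
    case True
    with e show thesis
      by (intro that(1)[of e]) (auto simp: side_chain_def e_def doubleton_eq_iff)
  next
    case False
    with e show thesis
      by (intro that(2)[of e]) (auto simp: side_chain_def e_def doubleton_eq_iff)
  qed
qed

lemma keys_side_chain: "i < face_size K f \<Longrightarrow> Poly_Mapping.keys (side_chain K f i) \<subseteq> cells K 1"
  by (erule side_cases) auto

lemma exterior_d_side:
  assumes "\<alpha> \<in> cochains K 0" "exterior_d K 0 \<alpha> \<in> cochains K 1" "i < face_size K f"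
  shows "exterior_d K 0 \<alpha> (side_chain K f i) =
         \<alpha> (frag_of (face_vertex K f (Suc i))) - \<alpha> (frag_of (face_vertex K f i))"
  using assms(3)
  by (cases rule: side_cases) (simp_all add: cochain_uminus[OF assms(2)] exterior_d_edge[OF polygonal assms(1)])

lemma exterior_d_face:
  assumes "\<beta> \<in> cochains K 1"
  shows "exterior_d K 1 \<beta> (frag_of f) = (\<Sum>i<face_size K f. \<beta> (side_chain K f i))"
  using face boundary_face[of K f] cochain_sum[OF assms, of "face_size K f" "side_chain K f"] keys_side_chain
  by (simp add: exterior_d_def carrier_chains_iff numeral_2_eq_2)

text \<open>The mean of \<open>\<alpha>\<close> over the end points of an edge ignores its orientation and \<open>\<beta>\<close> changes sign
  with it, so the formula for an edge also holds for a side oriented along the face.\<close>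

lemma cup01_side:
  assumes "\<beta> \<in> cochains K 1" "i < face_size K f"
  shows "cochain_of K 1 (cup01 K \<alpha> \<beta>) (side_chain K f i) =
         1/2 * (\<alpha> (frag_of (face_vertex K f i)) + \<alpha> (frag_of (face_vertex K f (Suc i))))
             * \<beta> (side_chain K f i)"
  using assms(2)
  by (cases rule: side_cases)
    (simp_all add: cochain_uminus[OF assms(1)] cochain_uminus[OF cochain_of_in_cochains]
      cochain_of_frag_of cup01_def)

lemma elementary_cochain_side:
  assumes "i < face_size K f" "\<not> is_face K \<sigma> f"
  shows "elementary_cochain K 1 \<sigma> (side_chain K f i) = 0"
  using assms(1)
  by (cases rule: side_cases)
    (use assms(2) in \<open>auto simp: elementary_cochain_def cochain_uminus[OF cochain_of_in_cochains]
      cochain_of_frag_of\<close>)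

text \<open>The Leibniz rule in degrees (1,0), solved for the product of 1-forms. The other order of the
  factors differs by a sign through \<open>cup11_anticommute\<close>, while the products with a 0-form are the same
  in both orders.\<close>

lemma cup11_leibniz:
  assumes "\<alpha> \<in> cochains K 0" "exterior_d K 0 \<alpha> \<in> cochains K 1" "\<beta> \<in> cochains K 1"
  shows "cup11 K \<beta> (exterior_d K 0 \<alpha>) f =
         cup02 K \<alpha> (exterior_d K 1 \<beta>) f - exterior_d K 1 (cochain_of K 1 (cup01 K \<alpha> \<beta>)) (frag_of f)"
proof -
  define p where "p = face_size K f"
  define u where "u = (\<lambda>i. \<alpha> (frag_of (face_vertex K f i)))"
  define y where "y = (\<lambda>i. \<beta> (side_chain K f i))"
  have u_mod: "u (Suc i mod p) = u (Suc i)" for i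
    using face_vertex_mod[of "Suc i"] by (simp add: u_def p_def)
  have "0 < p" using face_size_ge_3 unfolding p_def by linarith
  have d_side: "exterior_d K 0 \<alpha> (side_chain K f j) = u (Suc j mod p) - u j" if "j < p" for j
    using exterior_d_side[OF assms(1,2), of j] that unfolding u_mod by (simp add: u_def p_def)
  have "cup11 K \<beta> (exterior_d K 0 \<alpha>) f = cyclic_product p y (\<lambda>i. exterior_d K 0 \<alpha> (side_chain K f i))"
    by (simp add: cup11_eq_cyclic_product y_def p_def)
  also have "\<dots> = cyclic_product p y (\<lambda>i. u (Suc i mod p) - u i)"
    unfolding cyclic_product_def
    by (intro sum.cong refl arg_cong2[where f = "(*)"] d_side mod_less_divisor \<open>0 < p\<close>)
  also have "\<dots> = 1 / real p * (\<Sum>i<p. u i) * (\<Sum>i<p. y i) - (\<Sum>i<p. 1/2 * (u i + u (Suc i)) * y i)"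
    using cyclic_product_differences[OF \<open>0 < p\<close>, of y u] by (simp add: u_mod)
  also have "(\<Sum>i<p. 1/2 * (u i + u (Suc i)) * y i)
      = exterior_d K 1 (cochain_of K 1 (cup01 K \<alpha> \<beta>)) (frag_of f)"
    unfolding exterior_d_face[OF cochain_of_in_cochains] p_def u_def y_def
    by (intro sum.cong refl) (simp only: lessThan_iff cup01_side[OF assms(3)])
  also have "1 / real p * (\<Sum>i<p. u i) * (\<Sum>i<p. y i) = cup02 K \<alpha> (exterior_d K 1 \<beta>) f"
    unfolding cup02_def exterior_d_face[OF assms(3)] p_def u_def y_def by (rule refl)
  finally show ?thesis .
qed

end

lemma exterior_d_in_cochains:
  assumes "oriented_polygonal K" "\<alpha> \<in> cochains K q"
  shows "exterior_d K q \<alpha> \<in> cochains K (Suc q)"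
proof -
  have keys: "Poly_Mapping.keys (boundary K (Suc q) c) \<subseteq> cells K q"
    if c: "Poly_Mapping.keys c \<subseteq> cells K (Suc q)" for c
  proof -
    have "Poly_Mapping.keys (boundary K (Suc q) (frag_of \<sigma>)) \<subseteq> cells K q" if \<sigma>: "\<sigma> \<in> cells K (Suc q)" for \<sigma>
    proof -
      consider "q = 0" | "q = 1" | "q \<ge> 2" by linarith
      then show ?thesis
      proof cases
        case 1
        then show ?thesis
          using \<sigma> oriented_polygonal_edge[OF assms(1), of \<sigma>] boundary_edge[of K \<sigma>]
            keys_diff[of "frag_of (edge_head K \<sigma>)" "frag_of (edge_tail K \<sigma>)"] by auto
      next
        case 2
        then have "polygonal_face K \<sigma>"
          using \<sigma> assms(1) by unfold_locales (simp_all add: numeral_2_eq_2)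
        then have "(\<Sum>i<face_size K \<sigma>. side_chain K \<sigma> i) \<in> carrier (free_Abelian_group (cells K 1))"
          using polygonal_face.keys_side_chain[of K \<sigma>] by (intro sum_closed_free_Abelian_group) simp
        then show ?thesis
          using boundary_face[of K \<sigma>] 2 by (simp add: numeral_2_eq_2)
      qed (simp add: boundary_def)
    qed
    moreover have "Poly_Mapping.keys (boundary K (Suc q) c)
        \<subseteq> (\<Union>\<sigma>\<in>Poly_Mapping.keys c. Poly_Mapping.keys (boundary K (Suc q) (frag_of \<sigma>)))"
      using keys_frag_extend unfolding boundary_def frag_extend_of by fastforce
    ultimately show ?thesis using c by blast
  qed
  have "boundary K (Suc q) (c + d) = boundary K (Suc q) c + boundary K (Suc q) d" for c d
    by (simp add: boundary_def frag_extend_add)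
  moreover have "Poly_Mapping.keys (c + d) \<subseteq> cells K (Suc q)"
    if "Poly_Mapping.keys c \<subseteq> cells K (Suc q)" "Poly_Mapping.keys d \<subseteq> cells K (Suc q)"
    for c d :: "'a set \<Rightarrow>\<^sub>0 int"
    using that keys_add[of c d] by blast
  ultimately show ?thesis
    unfolding cochains_iff exterior_d_def carrier_chains_iff
    using keys cochain_add[OF assms(2)] by simp
qed

section \<open>The polygonal cup product\<close>

lemma polygonal_cup_in_cochains: "polygonal_cup K p q \<alpha> \<beta> \<in> cochains K (p + q)"
  by (simp add: polygonal_cup_def cochain_of_in_cochains)

text \<open>The degrees are in successor form, as they occur in the Leibniz rule.\<close>

lemma polygonal_cup_0_0: "polygonal_cup K 0 0 \<alpha> \<beta> = cochain_of K 0 (\<lambda>v. \<alpha> (frag_of v) * \<beta> (frag_of v))"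
  and polygonal_cup_0_1: "polygonal_cup K 0 (Suc 0) \<alpha> \<beta> = cochain_of K 1 (cup01 K \<alpha> \<beta>)"
  and polygonal_cup_1_0: "polygonal_cup K (Suc 0) 0 \<alpha> \<beta> = cochain_of K 1 (cup01 K \<beta> \<alpha>)"
  and polygonal_cup_0_2: "polygonal_cup K 0 (Suc (Suc 0)) \<alpha> \<beta> = cochain_of K 2 (cup02 K \<alpha> \<beta>)"
  and polygonal_cup_2_0: "polygonal_cup K (Suc (Suc 0)) 0 \<alpha> \<beta> = cochain_of K 2 (cup02 K \<beta> \<alpha>)"
  and polygonal_cup_1_1: "polygonal_cup K (Suc 0) (Suc 0) \<alpha> \<beta> = cochain_of K 2 (cup11 K \<alpha> \<beta>)"
  by (simp_all add: polygonal_cup_def numeral_2_eq_2)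

lemmas polygonal_cup_simps = polygonal_cup_0_0 polygonal_cup_0_1 polygonal_cup_1_0
  polygonal_cup_0_2 polygonal_cup_2_0 polygonal_cup_1_1

lemma cup01_linear:
  "cup01 K (\<lambda>c. a * \<alpha> c + b * \<alpha>' c) \<beta> e = a * cup01 K \<alpha> \<beta> e + b * cup01 K \<alpha>' \<beta> e"
  "cup01 K \<alpha> (\<lambda>c. a * \<beta> c + b * \<beta>' c) e = a * cup01 K \<alpha> \<beta> e + b * cup01 K \<alpha> \<beta>' e"
  by (simp_all add: cup01_def algebra_simps)

lemma cup02_linear:
  "cup02 K (\<lambda>c. a * \<alpha> c + b * \<alpha>' c) \<beta> f = a * cup02 K \<alpha> \<beta> f + b * cup02 K \<alpha>' \<beta> f"
  "cup02 K \<alpha> (\<lambda>c. a * \<beta> c + b * \<beta>' c) f = a * cup02 K \<alpha> \<beta> f + b * cup02 K \<alpha> \<beta>' f"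
  by (simp_all add: cup02_def sum.distrib add_divide_distrib distrib_left distrib_right mult_ac
      flip: sum_distrib_left)

lemma cup11_linear:
  "cup11 K (\<lambda>c. a * \<alpha> c + b * \<alpha>' c) \<beta> f = a * cup11 K \<alpha> \<beta> f + b * cup11 K \<alpha>' \<beta> f"
  "cup11 K \<alpha> (\<lambda>c. a * \<beta> c + b * \<beta>' c) f = a * cup11 K \<alpha> \<beta> f + b * cup11 K \<alpha> \<beta>' f"
  by (simp_all add: cup11_eq_cyclic_product cyclic_product_linear_left cyclic_product_linear_right)

lemma bilinear_polygonal_cup: "bilinear_product K (polygonal_cup K)"
proof -
  have "polygonal_cup K p q (\<lambda>c. a * \<alpha> c + b * \<alpha>' c) \<beta>
      = (\<lambda>c. a * polygonal_cup K p q \<alpha> \<beta> c + b * polygonal_cup K p q \<alpha>' \<beta> c)" for p q a b \<alpha> \<alpha>' \<beta>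
    unfolding polygonal_cup_def cochain_of_linear[symmetric]
    by (intro arg_cong[where f = "cochain_of K (p + q)"] ext)
      (simp add: cup01_linear cup02_linear cup11_linear algebra_simps)
  moreover have "polygonal_cup K p q \<alpha> (\<lambda>c. a * \<beta> c + b * \<beta>' c)
      = (\<lambda>c. a * polygonal_cup K p q \<alpha> \<beta> c + b * polygonal_cup K p q \<alpha> \<beta>' c)" for p q a b \<alpha> \<beta> \<beta>'
    unfolding polygonal_cup_def cochain_of_linear[symmetric]
    by (intro arg_cong[where f = "cochain_of K (p + q)"] ext)
      (simp add: cup01_linear cup02_linear cup11_linear algebra_simps)
  ultimately show ?thesis
    unfolding bilinear_product_def using polygonal_cup_in_cochains by blast
qed

lemma pseudomanifold_cell_dimension:
  assumes "CW_pseudomanifold n K" "\<sigma> \<in> cells K q"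
  shows "q \<le> n"
proof (rule ccontr)
  assume "\<not> q \<le> n"
  moreover have "\<forall>q>n. cells K q = {}"
    using assms(1) unfolding CW_pseudomanifold_def by (elim conjE)
  ultimately show False using assms(2) by auto
qed

lemma is_face_refl:
  assumes "finite_regular_CW K" "\<sigma> \<in> cells K q"
  shows "is_face K \<sigma> \<sigma>"
proof -
  have "topspace (underlying K) = (\<Union>q. \<Union>(cells K q))"
    using assms(1) unfolding finite_regular_CW_def by (elim conjE)
  then have "\<sigma> \<subseteq> topspace (underlying K)" using assms(2) by blast
  then show ?thesis by (simp add: is_face_def closure_of_subset)
qed

lemma cup01_elementary_nonzero:
  assumes "finite_regular_CW K" "oriented_polygonal K" "e \<in> cells K 1"
    and "cup01 K (elementary_cochain K 0 \<sigma>) (elementary_cochain K 1 \<tau>) e \<noteq> 0"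
  shows "is_face K \<sigma> e" "is_face K \<tau> e"
proof -
  have "edge_tail K e = \<sigma> \<or> edge_head K e = \<sigma>" "e = \<tau>"
    using assms(3,4) oriented_polygonal_edge[OF assms(2,3)]
    by (auto simp: cup01_def elementary_cochain_frag_of split: if_split_asm)
  then show "is_face K \<sigma> e" "is_face K \<tau> e"
    using oriented_polygonal_edge[OF assms(2,3)] is_face_refl[OF assms(1,3)] by metis+
qed

lemma cup02_elementary_nonzero:
  assumes "finite_regular_CW K" "oriented_polygonal K" "f \<in> cells K 2"
    and "cup02 K (elementary_cochain K 0 \<sigma>) (elementary_cochain K 2 \<tau>) f \<noteq> 0"
  shows "is_face K \<sigma> f" "is_face K \<tau> f"
proof -
  interpret polygonal_face K f using assms by unfold_locales
  show "is_face K \<tau> f"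
    using assms(3,4) is_face_refl[OF assms(1,3)]
    by (auto simp: cup02_def elementary_cochain_frag_of split: if_splits)
  show "is_face K \<sigma> f"
  proof (rule ccontr)
    assume "\<not> is_face K \<sigma> f"
    then have "elementary_cochain K 0 \<sigma> (frag_of (face_vertex K f i)) = 0" for i
      using face_vertex_is_vertex[of i] by (auto simp: elementary_cochain_frag_of)
    then show False
      using assms(4) by (simp add: cup02_def)
  qed
qed

lemma cup11_elementary_nonzero:
  assumes "oriented_polygonal K" "f \<in> cells K 2"
    and "cup11 K (elementary_cochain K 1 \<sigma>) (elementary_cochain K 1 \<tau>) f \<noteq> 0"
  shows "is_face K \<sigma> f" "is_face K \<tau> f"
proof -
  interpret polygonal_face K f using assms by unfold_locales
  have side: "elementary_cochain K 1 \<rho> (side_chain K f i) = 0"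
    if "\<not> is_face K \<rho> f" "i \<in> {..<face_size K f}" for \<rho> i
    using elementary_cochain_side[OF _ that(1)] that(2) unfolding lessThan_iff .
  have zero: "cup11 K (elementary_cochain K 1 \<rho>) \<beta> f = 0" if "\<not> is_face K \<rho> f" for \<rho> \<beta>
    unfolding cup11_eq_cyclic_product cyclic_product_def
    by (rule sum.neutral, rule ballI, subst side[OF that], assumption, rule mult_zero_left)
  show "is_face K \<sigma> f"
    using assms(3) zero by metis
  show "is_face K \<tau> f"
    using assms(3) zero cup11_anticommute[of K "elementary_cochain K 1 \<sigma>" "elementary_cochain K 1 \<tau>" f]
    by (metis neg_equal_0_iff_equal)
qed

lemma polygonal_cup_local:
  assumes "CW_pseudomanifold 2 K" "oriented_polygonal K"
  shows "polygonal_cup K p q (elementary_cochain K p \<sigma>) (elementary_cochain K q \<tau>)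
           \<in> cochains_in K (p + q) (star K \<sigma> \<inter> star K \<tau>)"
proof -
  have CW: "finite_regular_CW K"
    using assms(1) unfolding CW_pseudomanifold_def by (elim conjE)
  have "is_face K \<sigma> \<rho> \<and> is_face K \<tau> \<rho>"
    if \<rho>: "\<rho> \<in> cells K (p + q)"
      and nz: "polygonal_cup K p q (elementary_cochain K p \<sigma>) (elementary_cochain K q \<tau>) (frag_of \<rho>) \<noteq> 0"
    for \<rho>
  proof -
    have "p + q \<le> 2" using pseudomanifold_cell_dimension[OF assms(1) \<rho>] .
    then consider "p = 0" "q = 0" | "p = 0" "q = 1" | "p = 1" "q = 0" | "p = 0" "q = 2"
      | "p = 2" "q = 0" | "p = 1" "q = 1" by linarith
    then show ?thesis
    proof cases
      case 1
      then show ?thesis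
        using nz \<rho> is_face_refl[OF CW \<rho>]
        by (auto simp: polygonal_cup_simps cochain_of_frag_of elementary_cochain_frag_of split: if_splits)
    next
      case 2
      then show ?thesis
        using nz \<rho> cup01_elementary_nonzero[OF CW assms(2), of \<rho> \<sigma> \<tau>]
        by (simp add: polygonal_cup_simps cochain_of_frag_of)
    next
      case 3
      then show ?thesis
        using nz \<rho> cup01_elementary_nonzero[OF CW assms(2), of \<rho> \<tau> \<sigma>]
        by (simp add: polygonal_cup_simps cochain_of_frag_of)
    next
      case 4
      then show ?thesis
        using nz \<rho> cup02_elementary_nonzero[OF CW assms(2), of \<rho> \<sigma> \<tau>]
        by (simp add: polygonal_cup_simps cochain_of_frag_of numeral_2_eq_2)
    next
      case 5
      then show ?thesis
        using nz \<rho> cup02_elementary_nonzero[OF CW assms(2), of \<rho> \<tau> \<sigma>]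
        by (simp add: polygonal_cup_simps cochain_of_frag_of numeral_2_eq_2)
    next
      case 6
      then show ?thesis
        using nz \<rho> cup11_elementary_nonzero[OF assms(2), of \<rho> \<sigma> \<tau>]
        by (simp add: polygonal_cup_simps cochain_of_frag_of numeral_2_eq_2)
    qed
  qed
  then show ?thesis
    using polygonal_cup_in_cochains unfolding cochains_in_def star_def by blast
qed

text \<open>Both sides are cochains of degree \<open>p + q + 1\<close>, so that only \<open>p + q \<le> 1\<close> matters. On an edge
  the rule is the identity \<open>a'b' - ab = (a' - a)(b + b')/2 + (a + a')(b' - b)/2\<close>.\<close>

lemma polygonal_cup_leibniz:
  assumes "CW_pseudomanifold 2 K" "oriented_polygonal K"
    and \<alpha>: "\<alpha> \<in> cochains K p" and \<beta>: "\<beta> \<in> cochains K q"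
  shows "exterior_d K (p + q) (polygonal_cup K p q \<alpha> \<beta>) =
           (\<lambda>c. polygonal_cup K (Suc p) q (exterior_d K p \<alpha>) \<beta> c
                + (-1) ^ p * polygonal_cup K p (Suc q) \<alpha> (exterior_d K q \<beta>) c)"
proof (rule cochain_eqI[where q = "Suc (p + q)"])
  show "exterior_d K (p + q) (polygonal_cup K p q \<alpha> \<beta>) \<in> cochains K (Suc (p + q))"
    by (intro exterior_d_in_cochains assms polygonal_cup_in_cochains)
  show "(\<lambda>c. polygonal_cup K (Suc p) q (exterior_d K p \<alpha>) \<beta> c
                + (-1) ^ p * polygonal_cup K p (Suc q) \<alpha> (exterior_d K q \<beta>) c) \<in> cochains K (Suc (p + q))"
    using cochains_linear[of "polygonal_cup K (Suc p) q (exterior_d K p \<alpha>) \<beta>" K "Suc (p + q)"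
        "polygonal_cup K p (Suc q) \<alpha> (exterior_d K q \<beta>)" 1 "(-1) ^ p"]
      polygonal_cup_in_cochains[of K "Suc p" q] polygonal_cup_in_cochains[of K p "Suc q"] by simp
  fix \<sigma> assume \<sigma>: "\<sigma> \<in> cells K (Suc (p + q))"
  have d: "\<And>\<gamma>. \<gamma> \<in> cochains K 0 \<Longrightarrow> exterior_d K 0 \<gamma> \<in> cochains K 1"
    using exterior_d_in_cochains[OF assms(2), of _ 0] by simp
  have "Suc (p + q) \<le> 2" using pseudomanifold_cell_dimension[OF assms(1) \<sigma>] .
  then consider "p = 0" "q = 0" | "p = 0" "q = 1" | "p = 1" "q = 0" by linarith
  then show "exterior_d K (p + q) (polygonal_cup K p q \<alpha> \<beta>) (frag_of \<sigma>) =
      polygonal_cup K (Suc p) q (exterior_d K p \<alpha>) \<beta> (frag_of \<sigma>)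
        + (-1) ^ p * polygonal_cup K p (Suc q) \<alpha> (exterior_d K q \<beta>) (frag_of \<sigma>)"
  proof cases
    case 1
    then have e: "\<sigma> \<in> cells K 1" using \<sigma> by simp
    show ?thesis
      using 1 \<alpha> \<beta> e oriented_polygonal_edge[OF assms(2) e]
      by (simp add: polygonal_cup_simps cochain_of_frag_of cup01_def
          exterior_d_edge[OF assms(2)] cochain_of_in_cochains field_simps)
  next
    case 2
    then interpret polygonal_face K \<sigma> using \<sigma> assms(2) by unfold_locales (simp_all add: numeral_2_eq_2)
    show ?thesis
      using 2 \<alpha> \<beta> face cup11_leibniz[of \<alpha> \<beta>] d[of \<alpha>]
      by (simp add: polygonal_cup_simps cochain_of_frag_of cup11_anticommute[of K "exterior_d K 0 \<alpha>" \<beta>])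
  next
    case 3
    then interpret polygonal_face K \<sigma> using \<sigma> assms(2) by unfold_locales (simp_all add: numeral_2_eq_2)
    show ?thesis
      using 3 \<alpha> \<beta> face cup11_leibniz[of \<beta> \<alpha>] d[of \<beta>]
      by (simp add: polygonal_cup_simps cochain_of_frag_of)
  qed
qed

lemma polygonal_cup_unit:
  assumes "CW_pseudomanifold 2 K" "oriented_polygonal K" "\<alpha> \<in> cochains K p"
  shows "polygonal_cup K 0 p (unit_cochain K) \<alpha> = \<alpha>" "polygonal_cup K p 0 \<alpha> (unit_cochain K) = \<alpha>"
proof -
  have unit: "unit_cochain K (frag_of v) = 1" if "v \<in> cells K 0" for v
    using that by (simp add: unit_cochain_def cochain_of_frag_of)
  have "polygonal_cup K 0 p (unit_cochain K) \<alpha> (frag_of \<sigma>) = \<alpha> (frag_of \<sigma>) \<and>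
        polygonal_cup K p 0 \<alpha> (unit_cochain K) (frag_of \<sigma>) = \<alpha> (frag_of \<sigma>)" if \<sigma>: "\<sigma> \<in> cells K p" for \<sigma>
  proof -
    have "p \<le> 2" using pseudomanifold_cell_dimension[OF assms(1) \<sigma>] .
    then consider "p = 0" | "p = 1" | "p = 2" by linarith
    then show ?thesis
    proof cases
      case 1
      then show ?thesis using \<sigma> by (simp add: polygonal_cup_simps cochain_of_frag_of unit)
    next
      case 2
      then show ?thesis
        using \<sigma> oriented_polygonal_edge[OF assms(2), of \<sigma>]
        by (simp add: polygonal_cup_simps cochain_of_frag_of cup01_def unit)
    next
      case 3
      then interpret polygonal_face K \<sigma> using \<sigma> assms(2) by unfold_locales simp_all
      show ?thesis
        using 3 face face_size_ge_3
        by (auto simp: polygonal_cup_simps cochain_of_frag_of cup02_def unit face_vertex_is_vertex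
            numeral_2_eq_2)
    qed
  qed
  then show "polygonal_cup K 0 p (unit_cochain K) \<alpha> = \<alpha>" "polygonal_cup K p 0 \<alpha> (unit_cochain K) = \<alpha>"
    using assms(3) polygonal_cup_in_cochains[of K 0 p] polygonal_cup_in_cochains[of K p 0]
    by (auto intro!: cochain_eqI[where q = p and K = K])
qed

theorem theorem4p1:
  fixes K :: "'a oriented_complex"
  assumes "CW_pseudomanifold 2 K"
    and "oriented_polygonal K"
  shows "cup_product K (polygonal_cup K)"
proof -
  have "\<exists>\<gamma>::real. \<forall>p. \<forall>\<alpha>\<in>cochains K p.
      polygonal_cup K 0 p (unit_cochain K) \<alpha> = (\<lambda>c. \<gamma> * \<alpha> c) \<and>
      polygonal_cup K p 0 \<alpha> (unit_cochain K) = (\<lambda>c. \<gamma> * \<alpha> c)"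
    by (rule exI[where x = 1]) (simp add: polygonal_cup_unit[OF assms])
  then show ?thesis
    unfolding cup_product_def
    using bilinear_polygonal_cup[of K] polygonal_cup_local[OF assms] polygonal_cup_leibniz[OF assms]
    by blast
qed

end
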